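(* For $n\geq 2$, the number $\kappa_n$ of kernel positions of rank $n$ in the original Bernoulli game is $$\kappa_n=\sum_{k=0}^{n-2}\sum_{1=i_0<i_1<\cdots<i_{k+1}=n}\prod_{j=0}^k (i_{j+1}-i_j-1)!^2\binom{i_{j+1}}{i_j+1}\binom{i_{j+1}}{i_j-1}.$$
   Context: The original Bernoulli game: positions of rank $n\ge1$ are pairs of words $(u_1\cdots u_n, v_1\cdots v_n)$ of positive integers with $1\le u_i,v_i\le i$ for all $i$. A valid move replaces $(u_1\cdots u_n,v_1\cdots v_n)$ by $(u_1\cdots u_m,v_1\cdots v_m)$ for some $1\le m<n$ satisfying $u_{m+1}\le v_j$ for all $j=m+1,\ldots,n$. Players alternate; a player unable to move loses. Kernel positions are positions of Grundy number zero (equivalently, positions from which every valid move leads to a non-kernel position). *)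

theory Defs
  imports Complex_Main
begin

text \<open>
  A word \<open>w\<^sub>1\<cdots>w\<^sub>n\<close> is a list of length \<open>n\<close>; its letter \<open>w\<^sub>i\<close> is \<open>w ! (i - 1)\<close>.
\<close>

definition bernoulli_word :: "nat \<Rightarrow> nat list \<Rightarrow> bool" where
  "bernoulli_word n w \<longleftrightarrow>
     length w = n \<and> (\<forall>i\<in>{1..n}. 1 \<le> w ! (i - 1) \<and> w ! (i - 1) \<le> i)"

definition bernoulli_positions :: "nat \<Rightarrow> (nat list \<times> nat list) set" where
  "bernoulli_positions n = {(u, v). n \<ge> 1 \<and> bernoulli_word n u \<and> bernoulli_word n v}"

definition bernoulli_moves :: "nat list \<times> nat list \<Rightarrow> (nat list \<times> nat list) set" where
  "bernoulli_moves p =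
     {q. \<exists>n u v m. p = (u, v) \<and> p \<in> bernoulli_positions n \<and>
         1 \<le> m \<and> m < n \<and>
         (\<forall>j\<in>{m+1..n}. u ! ((m + 1) - 1) \<le> v ! (j - 1)) \<and>
         q = (take m u, take m v)}"

definition mex :: "nat set \<Rightarrow> nat" where
  "mex S = (LEAST k. k \<notin> S)"

lemma bernoulli_moves_decreases:
  assumes "q \<in> bernoulli_moves p"
  shows "length (fst q) < length (fst p)"
  using assms
  by (auto simp: bernoulli_moves_def bernoulli_positions_def bernoulli_word_def)

function grundy :: "nat list \<times> nat list \<Rightarrow> nat" where
  "grundy p = mex (grundy ` bernoulli_moves p)"
  by auto
termination
  by (relation "measure (\<lambda>p. length (fst p))") (auto dest: bernoulli_moves_decreases)

declare grundy.simps [simp del]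

definition kernel_positions :: "nat \<Rightarrow> (nat list \<times> nat list) set" where
  "kernel_positions n = {p \<in> bernoulli_positions n. grundy p = 0}"

definition kappa :: "nat \<Rightarrow> nat" where
  "kappa n = card (kernel_positions n)"

text \<open>
  The sequences \<open>1 = i\<^sub>0 < i\<^sub>1 < \<cdots> < i\<^bsub>k+1\<^esub> = n\<close>, as lists with \<open>i ! j\<close> standing for \<open>i\<^sub>j\<close>.
\<close>

definition index_chains :: "nat \<Rightarrow> nat \<Rightarrow> nat list set" where
  "index_chains k n =
     {i. length i = k + 2 \<and> sorted_wrt (<) i \<and> i ! 0 = 1 \<and> i ! (k + 1) = n}"

text \<open>
  These sets are finite, so sums over them and their cardinalities carry no junk values.
\<close>

lemma finite_bernoulli_positions: "finite (bernoulli_positions n)"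
proof -
  have "set w \<subseteq> {..n} \<and> length w = n" if "bernoulli_word n w" for w
  proof -
    have "w ! k \<le> n" if "k < n" for k
      using \<open>bernoulli_word n w\<close> that unfolding bernoulli_word_def
      by (auto dest!: bspec[where x = "Suc k"])
    then show ?thesis
      using \<open>bernoulli_word n w\<close> by (auto simp: bernoulli_word_def in_set_conv_nth)
  qed
  then have "bernoulli_positions n \<subseteq>
      {w. set w \<subseteq> {..n} \<and> length w = n} \<times> {w. set w \<subseteq> {..n} \<and> length w = n}"
    by (auto simp: bernoulli_positions_def)
  then show ?thesis
    by (rule finite_subset) (auto intro!: finite_cartesian_product finite_lists_length_eq)
qed

lemma finite_index_chains: "finite (index_chains k n)"
proof -
  have "set i \<subseteq> {..n}" if i: "i \<in> index_chains k n" for i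
  proof
    fix x assume "x \<in> set i"
    then obtain j where j: "j < k + 2" "x = i ! j"
      using i by (auto simp: in_set_conv_nth index_chains_def)
    show "x \<in> {..n}"
    proof (cases "j = k + 1")
      case True
      then show ?thesis using i j by (auto simp: index_chains_def)
    next
      case False
      then have "i ! j < i ! (k + 1)"
        using i j by (auto simp: index_chains_def intro!: sorted_wrt_nth_less[of "(<)"])
      then show ?thesis using i j by (auto simp: index_chains_def)
    qed
  qed
  then have "index_chains k n \<subseteq> {i. set i \<subseteq> {..n} \<and> length i = k + 2}"
    by (auto simp: index_chains_def)
  then show ?thesis
    by (rule finite_subset) (auto intro!: finite_lists_length_eq)
qed

end

theory Submission
  imports Defs
begin

text \<open>
  Let \<open>1 = i\<^sub>0 < i\<^sub>1 < \<cdots>\<close> be the ranks of the kernel prefixes of a position. Once some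
  \<open>v\<^sub>j < u\<^bsub>m+1\<^esub>\<close> with \<open>j > m\<close> has blocked the move to the prefix of rank \<open>m\<close>, that move stays
  blocked for all longer prefixes. Hence \<open>b = i\<^bsub>k+1\<^esub>\<close> is the least index beyond \<open>a = i\<^sub>k\<close> with
  \<open>v\<^sub>b < u\<^bsub>a+1\<^esub>\<close>, so every kernel position of rank \<open>n \<ge> 2\<close> has a unique last kernel prefix, and the
  letters after it can be chosen independently of that prefix. Summing over \<open>x = u\<^bsub>a+1\<^esub>\<close>, these letters
  can be chosen in
  \[\frac{b!}{(a+1)!} \sum_{x=1}^{a+1} (x-1) \frac{(b-x)!}{(a+1-x)!}
    = (b-a-1)!^2 \binom{b}{a+1} \binom{b}{a-1}\]
  ways, by a Vandermonde-type convolution.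
\<close>

subsection \<open>Kernel prefixes\<close>

text \<open>A finite set misses some natural number, so the \<open>LEAST\<close> in
  \<open>mex\<close> is attained.\<close>

lemma mex_eq_0_iff: "mex S = 0 \<longleftrightarrow> 0 \<notin> S" if "finite S"
proof
  have "\<exists>k. k \<notin> S"
    using that by (metis ex_new_if_finite infinite_UNIV_nat)
  then have "mex S \<notin> S"
    unfolding mex_def by (rule LeastI_ex)
  then show "0 \<notin> S" if "mex S = 0"
    using that by simp
next
  show "mex S = 0" if "0 \<notin> S"
    using that unfolding mex_def by (simp add: Least_eq_0)
qed

text \<open>Switches to indices starting at 0, as used by \<open>nth\<close>; the bound on
  \<open>w ! i\<close> becomes \<open>Suc i\<close>.\<close>

lemma bernoulli_word_iff:
  "bernoulli_word n w \<longleftrightarrow> length w = n \<and> (\<forall>i<n. w ! i \<in> {1..Suc i})"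
proof -
  have "(\<forall>i\<in>{1..n}. 1 \<le> w ! (i - 1) \<and> w ! (i - 1) \<le> i) \<longleftrightarrow> (\<forall>i<n. w ! i \<in> {1..Suc i})"
  proof (intro iffI allI ballI impI)
    fix i assume "\<forall>i\<in>{1..n}. 1 \<le> w ! (i - 1) \<and> w ! (i - 1) \<le> i" "i < n"
    then show "w ! i \<in> {1..Suc i}"
      by (auto dest: bspec[of _ _ "Suc i"])
  next
    fix i assume "\<forall>i<n. w ! i \<in> {1..Suc i}" "i \<in> {1..n}"
    then show "1 \<le> w ! (i - 1) \<and> w ! (i - 1) \<le> i"
      by (auto dest: spec[of _ "i - 1"])
  qed
  then show ?thesis
    by (simp add: bernoulli_word_def)
qed

lemma take_in_bernoulli_positions:
  assumes "(u, v) \<in> bernoulli_positions n" "1 \<le> m" "m \<le> n"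
  shows "(take m u, take m v) \<in> bernoulli_positions m"
  using assms by (auto simp: bernoulli_positions_def bernoulli_word_iff)

lemma bernoulli_moves_eq:
  assumes "(u, v) \<in> bernoulli_positions n"
  shows "bernoulli_moves (u, v) =
    {(take m u, take m v) | m. 1 \<le> m \<and> m < n \<and> (\<forall>j. m \<le> j \<and> j < n \<longrightarrow> u ! m \<le> v ! j)}"
proof -
  have *: "(\<forall>j\<in>{m+1..n}. u ! ((m + 1) - 1) \<le> v ! (j - 1)) \<longleftrightarrow>
      (\<forall>j. m \<le> j \<and> j < n \<longrightarrow> u ! m \<le> v ! j)" for m
  proof (intro iffI allI ballI impI)
    fix j assume "\<forall>j\<in>{m+1..n}. u ! ((m + 1) - 1) \<le> v ! (j - 1)" "m \<le> j \<and> j < n"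
    then show "u ! m \<le> v ! j"
      by (auto dest: bspec[of _ _ "Suc j"])
  next
    fix j assume "\<forall>j. m \<le> j \<and> j < n \<longrightarrow> u ! m \<le> v ! j" "j \<in> {m+1..n}"
    then show "u ! ((m + 1) - 1) \<le> v ! (j - 1)"
      by (auto dest: spec[of _ "j - 1"])
  qed
  have "(u, v) \<in> bernoulli_positions n' \<longleftrightarrow> n' = n" for n'
    using assms by (auto simp: bernoulli_positions_def bernoulli_word_def)
  then show ?thesis
    unfolding bernoulli_moves_def by (auto simp: *[simplified])
qed

text \<open>Every option of a prefix is a shorter prefix of the same position, so being a kernel
  prefix can be decided recursively on ranks, reading letters of the full words \<open>u\<close> and
  \<open>v\<close> only.\<close>

lemma take_in_kernel_positions_iff:
  assumes p: "(u, v) \<in> bernoulli_positions n" and m: "1 \<le> m" "m \<le> n"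
  shows "(take m u, take m v) \<in> kernel_positions m \<longleftrightarrow>
    (\<forall>l. 1 \<le> l \<and> l < m \<and> (take l u, take l v) \<in> kernel_positions l \<longrightarrow>
         (\<exists>j. l \<le> j \<and> j < m \<and> v ! j < u ! l))"
proof -
  let ?p = "(take m u, take m v)"
  have pm: "?p \<in> bernoulli_positions m"
    using take_in_bernoulli_positions[OF p m] .
  have moves: "bernoulli_moves ?p =
      {(take l u, take l v) | l. 1 \<le> l \<and> l < m \<and> (\<forall>j. l \<le> j \<and> j < m \<longrightarrow> u ! l \<le> v ! j)}"
    unfolding bernoulli_moves_eq[OF pm] by (intro Collect_cong ex_cong1) (auto simp: min_absorb1)
  have "bernoulli_moves ?p \<subseteq> (\<lambda>l. (take l u, take l v)) ` {..<m}"
    unfolding moves by auto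
  then have fin: "finite (grundy ` bernoulli_moves ?p)"
    by (meson finite_imageI finite_lessThan finite_subset)
  have "?p \<in> kernel_positions m \<longleftrightarrow> grundy ?p = 0"
    using pm by (simp add: kernel_positions_def)
  also have "\<dots> \<longleftrightarrow> (\<forall>q \<in> bernoulli_moves ?p. grundy q \<noteq> 0)"
    unfolding grundy.simps[of ?p] mex_eq_0_iff[OF fin] by force
  also have "\<dots> \<longleftrightarrow> (\<forall>l. 1 \<le> l \<and> l < m \<and> (\<forall>j. l \<le> j \<and> j < m \<longrightarrow> u ! l \<le> v ! j) \<longrightarrow>
         grundy (take l u, take l v) \<noteq> 0)"
    unfolding moves by blast
  also have "\<dots> \<longleftrightarrow> (\<forall>l. 1 \<le> l \<and> l < m \<and> grundy (take l u, take l v) = 0 \<longrightarrow>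
         (\<exists>j. l \<le> j \<and> j < m \<and> v ! j < u ! l))"
    by (meson not_le)
  also have "\<dots> \<longleftrightarrow> (\<forall>l. 1 \<le> l \<and> l < m \<and> (take l u, take l v) \<in> kernel_positions l \<longrightarrow>
         (\<exists>j. l \<le> j \<and> j < m \<and> v ! j < u ! l))"
    using take_in_bernoulli_positions[OF p] m
    by (auto simp: kernel_positions_def)
  finally show ?thesis .
qed

text \<open>In 1-based terms, the move to the kernel prefix of rank \<open>a\<close> is blocked for
  the first time by the letter \<open>v\<^sub>n\<close>.\<close>

definition kernel_extensions :: "nat \<Rightarrow> nat \<Rightarrow> (nat list \<times> nat list) set" where
  "kernel_extensions a n = {(u, v) \<in> bernoulli_positions n.
     (take a u, take a v) \<in> kernel_positions a \<and>
     (\<forall>j. a \<le> j \<and> j < n - 1 \<longrightarrow> u ! a \<le> v ! j) \<and> v ! (n - 1) < u ! a}"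

text \<open>At a rank strictly between \<open>a\<close> and \<open>n\<close> the move to rank
  \<open>a\<close> is still open, which excludes a kernel prefix there. At rank \<open>n\<close> it
  is blocked by the last letter of \<open>v\<close>, and moves to kernel prefixes shorter than
  \<open>a\<close> were blocked already within the prefix of rank \<open>a\<close>.\<close>

lemma kernel_extensions_next_kernel_prefix:
  assumes p: "(u, v) \<in> kernel_extensions a n" and a: "1 \<le> a" "a < n"
  shows "(u, v) \<in> kernel_positions n"
    and "\<And>m. a < m \<Longrightarrow> m < n \<Longrightarrow> (take m u, take m v) \<notin> kernel_positions m"
proof -
  have pos: "(u, v) \<in> bernoulli_positions n"
    and ka: "(take a u, take a v) \<in> kernel_positions a"
    and ge: "\<And>j. a \<le> j \<Longrightarrow> j < n - 1 \<Longrightarrow> u ! a \<le> v ! j"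
    and lt: "v ! (n - 1) < u ! a"
    using p by (auto simp: kernel_extensions_def)
  note K = take_in_kernel_positions_iff[OF pos]
  show *: "(take m u, take m v) \<notin> kernel_positions m" if m: "a < m" "m < n" for m
  proof
    assume "(take m u, take m v) \<in> kernel_positions m"
    then obtain j where "a \<le> j" "j < m" "v ! j < u ! a"
      using K[of m] ka a m by auto
    moreover from this m have "j < n - 1" by linarith
    ultimately show False using ge[of j] by simp
  qed
  have "\<exists>j. l \<le> j \<and> j < n \<and> v ! j < u ! l"
    if l: "1 \<le> l" "l < n" "(take l u, take l v) \<in> kernel_positions l" for l
  proof (cases l a rule: linorder_cases)
    case less
    then show ?thesis
      using K[of a] ka a l by (meson less_imp_le less_trans)
  next
    case equal
    then show ?thesis
      using lt a by (intro exI[of _ "n - 1"]) auto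
  next
    case greater
    then show ?thesis
      using *[of l] l by blast
  qed
  then have "(take n u, take n v) \<in> kernel_positions n"
    using K[of n] a by auto
  moreover have "length u = n" "length v = n"
    using pos by (auto simp: bernoulli_positions_def bernoulli_word_iff)
  ultimately show "(u, v) \<in> kernel_positions n"
    by simp
qed

text \<open>The prefix of rank 1 has no moves, so a largest rank \<open>a\<close> of a proper kernel
  prefix exists. If the move to it were blocked before the last letter, the prefix ending at the
  first blocking letter would be a longer proper kernel prefix.\<close>

lemma kernel_position_in_kernel_extensions:
  assumes p: "(u, v) \<in> kernel_positions n" and n: "2 \<le> n"
  shows "\<exists>a\<in>{1..<n}. (u, v) \<in> kernel_extensions a n"
proof -
  have pos: "(u, v) \<in> bernoulli_positions n"
    using p by (simp add: kernel_positions_def)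
  have len: "length u = n" "length v = n"
    using pos by (auto simp: bernoulli_positions_def bernoulli_word_iff)
  note K = take_in_kernel_positions_iff[OF pos]
  define S where "S = {m. 1 \<le> m \<and> m < n \<and> (take m u, take m v) \<in> kernel_positions m}"
  define a where "a = Max S"
  have "finite S"
    by (rule finite_subset[of _ "{..n}"]) (auto simp: S_def)
  moreover have "1 \<in> S"
    unfolding S_def using K[of 1] n by auto
  ultimately have aS: "a \<in> S" and amax: "\<And>m. m \<in> S \<Longrightarrow> m \<le> a"
    unfolding a_def using Max_in by auto
  have a: "1 \<le> a" "a < n" and ka: "(take a u, take a v) \<in> kernel_positions a"
    using aS by (auto simp: S_def)
  obtain j where j: "a \<le> j" "j < n" "v ! j < u ! a"
    using K[of n] p a ka n len by auto
  \<comment> \<open>The predicate does not bound the index by \<open>n\<close>; the bound comes from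
    \<open>j0 \<le> j\<close> below.\<close>
  define j0 where "j0 = (LEAST j. a \<le> j \<and> v ! j < u ! a)"
  have j0: "a \<le> j0" "v ! j0 < u ! a"
    using LeastI[of "\<lambda>j. a \<le> j \<and> v ! j < u ! a" j] j by (auto simp: j0_def)
  have least: "u ! a \<le> v ! i" if "a \<le> i" "i < j0" for i
    using not_less_Least[of i "\<lambda>j. a \<le> j \<and> v ! j < u ! a"] that by (auto simp: j0_def)
  have "j0 \<le> j"
    unfolding j0_def by (rule Least_le) (use j in auto)
  have "j0 = n - 1"
  proof (rule ccontr)
    assume "j0 \<noteq> n - 1"
    with \<open>j0 \<le> j\<close> j have j0n: "Suc j0 < n" by simp
    have "\<exists>j. l \<le> j \<and> j < Suc j0 \<and> v ! j < u ! l"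
      if l: "1 \<le> l" "l < Suc j0" "(take l u, take l v) \<in> kernel_positions l" for l
    proof (cases "l = a")
      case True
      then show ?thesis using j0 by auto
    next
      case False
      then have "l < a"
        using amax[of l] l j0n by (auto simp: S_def)
      then obtain i where "l \<le> i" "i < a" "v ! i < u ! l"
        using K[of a] ka a l by auto
      then show ?thesis
        using j0 by (intro exI[of _ i]) auto
    qed
    then have "Suc j0 \<in> S"
      unfolding S_def using K[of "Suc j0"] j0n by auto
    then show False
      using amax[of "Suc j0"] j0 by simp
  qed
  then have "(u, v) \<in> kernel_extensions a n"
    using pos ka j0 least by (auto simp: kernel_extensions_def)
  then show ?thesis using a by auto
qed

lemma kernel_positions_decomp:
  assumes "2 \<le> n"
  shows "kernel_positions n = (\<Union>a\<in>{1..<n}. kernel_extensions a n)"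
  using kernel_position_in_kernel_extensions[OF _ assms] kernel_extensions_next_kernel_prefix(1)
  by fastforce

lemma disjoint_kernel_extensions:
  assumes "1 \<le> a" "a < b" "b < n"
  shows "kernel_extensions a n \<inter> kernel_extensions b n = {}"
proof -
  have False if "(u, v) \<in> kernel_extensions a n" "(u, v) \<in> kernel_extensions b n" for u v
  proof -
    have "(take b u, take b v) \<in> kernel_positions b"
      using that by (simp add: kernel_extensions_def)
    with kernel_extensions_next_kernel_prefix(2)[OF that(1), of b] assms show False
      by simp
  qed
  then show ?thesis by auto
qed

lemma finite_kernel_extensions: "finite (kernel_extensions a n)"
  by (rule finite_subset[OF _ finite_bernoulli_positions[of n]]) (auto simp: kernel_extensions_def)

lemma kappa_eq_sum_card_kernel_extensions:
  assumes "2 \<le> n"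
  shows "kappa n = (\<Sum>a = 1..<n. card (kernel_extensions a n))"
  unfolding kappa_def kernel_positions_decomp[OF assms]
proof (rule card_UN_disjoint)
  show "\<forall>a\<in>{1..<n}. \<forall>b\<in>{1..<n}. a \<noteq> b \<longrightarrow> kernel_extensions a n \<inter> kernel_extensions b n = {}"
    using disjoint_kernel_extensions by (metis atLeastLessThan_iff inf_commute nat_neq_iff)
qed (auto simp: finite_kernel_extensions)

subsection \<open>Counting extensions\<close>

text \<open>The letter set depends on the place, since the two tails counted below have different
  bounds at each place.\<close>

definition words :: "nat \<Rightarrow> (nat \<Rightarrow> 'a set) \<Rightarrow> 'a list set" where
  "words n A = {w. length w = n \<and> (\<forall>i<n. w ! i \<in> A i)}"

lemma words_Suc: "words (Suc n) A = (\<lambda>(w, x). w @ [x]) ` (words n A \<times> A n)"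
proof (intro equalityI subsetI)
  fix w assume "w \<in> words (Suc n) A"
  then have "w = take n w @ [w ! n]" "take n w \<in> words n A" "w ! n \<in> A n"
    by (auto simp: words_def take_Suc_conv_app_nth[symmetric])
  then show "w \<in> (\<lambda>(w, x). w @ [x]) ` (words n A \<times> A n)"
    by (metis (no_types, lifting) SigmaI case_prod_conv image_eqI)
qed (auto simp: words_def nth_append less_Suc_eq)

lemma card_words: "card (words n A) = (\<Prod>i<n. card (A i))"
proof (induction n)
  case 0
  then show ?case by (simp add: words_def)
next
  case (Suc n)
  have "card (words (Suc n) A) = card (words n A \<times> A n)"
    unfolding words_Suc by (rule card_image) (auto simp: inj_on_def)
  then show ?case
    using Suc by (simp add: card_cartesian_product)
qed

lemma finite_words: "(\<And>i. finite (A i)) \<Longrightarrow> finite (words n A)"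
  by (induction n) (auto simp: words_Suc words_def[of 0])

text \<open>The product is (c+d)!/c!; multiplying by \<open>fact c\<close> first avoids division in
  the naturals.\<close>

lemma prod_consecutive_eq_fact_mult_binomial: "(\<Prod>i<d. Suc (c + i)) = fact d * (c + d choose d)"
proof -
  have "(\<Prod>i<d. Suc (c + i)) * fact c = fact (c + d)"
    by (induction d) (auto simp: algebra_simps)
  also have "\<dots> = fact d * (c + d choose d) * fact c"
    using binomial_fact_lemma[of d "c + d"] by (simp add: algebra_simps)
  finally show ?thesis by simp
qed

text \<open>Counts the subsets of {0,...,a+d} with d+2 elements by their second smallest element y.
  The induction obtains the increment from the hockey-stick identity and closes with Pascal's
  rule.\<close>

lemma sum_mult_choose: "(\<Sum>y\<le>a. y * (a - y + d choose d)) = (a + d + 1 choose (d + 2))"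
proof (induction a)
  case (Suc a)
  \<comment> \<open>The term for 0 vanishes, and after the shift \<open>Suc y\<close> splits into
    the old sum and a plain sum of binomials.\<close>
  have "(\<Sum>y\<le>Suc a. y * (Suc a - y + d choose d)) = (\<Sum>y\<le>a. Suc y * (a - y + d choose d))"
    by (subst sum.atMost_Suc_shift) simp
  also have "\<dots> = (\<Sum>y\<le>a. y * (a - y + d choose d)) + (\<Sum>y\<le>a. a - y + d choose d)"
    by (simp add: sum.distrib)
  also have "(\<Sum>y\<le>a. a - y + d choose d) = (\<Sum>k\<le>a. d + k choose k)"
  proof -
    have "(\<Sum>y\<le>a. a - y + d choose d) = (\<Sum>k\<le>a. k + d choose d)"
      by (rule sum.reindex_bij_witness[of _ "\<lambda>k. a - k" "\<lambda>k. a - k"]) auto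
    then show ?thesis
      by (simp add: binomial_symmetric[of d] add.commute)
  qed
  also have "\<dots> = (a + d + 1 choose (d + 1))"
    unfolding sum_choose_lower by (subst binomial_symmetric) (auto simp: add.commute)
  finally show ?case
    using Suc by (simp add: add.commute[of d a])
qed simp

lemma bij_betw_kernel_extensions:
  "bij_betw (\<lambda>((u, v), x, u', v', z). (u @ x # u', v @ v' @ [z]))
    (kernel_positions a \<times> (SIGMA x:{1..Suc a}.
        words d (\<lambda>i. {1..a + 2 + i}) \<times> words d (\<lambda>i. {x..a + 1 + i}) \<times> {1..<x}))
    (kernel_extensions a (Suc (a + d)))" (is "bij_betw ?f ?A ?B")
proof -
  let ?g = "\<lambda>(u, v). ((take a u, take a v), u ! a, drop (Suc a) u, take d (drop a v), v ! (a + d))"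
  show ?thesis
  proof (rule bij_betw_byWitness[where f' = ?g])
    show "\<forall>p\<in>?A. ?g (?f p) = p"
      by (auto simp: kernel_positions_def bernoulli_positions_def bernoulli_word_iff words_def nth_append)
    show "\<forall>p\<in>?B. ?f (?g p) = p"
    proof
      fix p assume "p \<in> ?B"
      moreover obtain u v where p: "p = (u, v)"
        by (cases p)
      ultimately have len: "length u = Suc (a + d)" "length v = Suc (a + d)"
        by (auto simp: kernel_extensions_def bernoulli_positions_def bernoulli_word_iff)
      have "take a v @ take d (drop a v) @ [v ! (a + d)] = take (Suc (a + d)) v"
        using len by (simp only: take_Suc_conv_app_nth take_add append_assoc)
      also have "\<dots> = v"
        using len by simp
      finally show "?f (?g p) = p"
        using len p by (simp add: id_take_nth_drop[symmetric])
    qed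
    show "?f ` ?A \<subseteq> ?B"
    proof clarify
      fix u v x u' v' z
      assume k: "(u, v) \<in> kernel_positions a" and x: "x \<in> {1..Suc a}"
        and u': "u' \<in> words d (\<lambda>i. {1..a + 2 + i})" and v': "v' \<in> words d (\<lambda>i. {x..a + 1 + i})"
        and z: "z \<in> {1..<x}"
      have len: "length u = a" "length v = a" "length u' = d" "length v' = d"
        using k u' v'
        by (auto simp: kernel_positions_def bernoulli_positions_def bernoulli_word_iff words_def)
      have bw: "u ! i \<in> {1..Suc i}" "v ! i \<in> {1..Suc i}" if "i < a" for i
        using k that by (auto simp: kernel_positions_def bernoulli_positions_def bernoulli_word_iff)
      have bu: "(u @ x # u') ! i \<in> {1..Suc i}" if "i < Suc (a + d)" for i
      proof (cases i a rule: linorder_cases)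
        case greater
        then obtain e where e: "i = a + Suc e"
          by (metis add_Suc_right less_imp_Suc_add)
        have "u' ! e \<in> {1..a + 2 + e}"
          using u' that e by (auto simp: words_def)
        then show ?thesis using e len by (simp add: nth_append)
      qed (use bw x len in \<open>auto simp: nth_append\<close>)
      have v'e: "v' ! e \<in> {x..a + 1 + e}" if "e < d" for e
        using v' that by (auto simp: words_def)
      have bv: "(v @ v' @ [z]) ! i \<in> {1..Suc i}" if i: "i < Suc (a + d)" for i
      proof -
        consider "i < a" | "a \<le> i" "i - a < d" | "i = a + d"
          using i by linarith
        then show ?thesis
        proof cases
          case 2
          then show ?thesis using v'e[of "i - a"] x len by (auto simp: nth_append)
        qed (use bw x z len in \<open>auto simp: nth_append\<close>)
      qed
      have "(u @ x # u', v @ v' @ [z]) \<in> bernoulli_positions (Suc (a + d))"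
        using bu bv len by (simp add: bernoulli_positions_def bernoulli_word_iff)
      moreover have "x \<le> (v @ v' @ [z]) ! j" if "a \<le> j" "j < a + d" for j
        using v'e[of "j - a"] that len by (auto simp: nth_append)
      ultimately show "(u @ x # u', v @ v' @ [z]) \<in> kernel_extensions a (Suc (a + d))"
        using k z len by (simp add: kernel_extensions_def nth_append)
    qed
    show "?g ` ?B \<subseteq> ?A"
    proof (rule image_subsetI)
      fix p assume "p \<in> ?B"
      moreover obtain u v where p: "p = (u, v)"
        by (cases p)
      ultimately have len: "length u = Suc (a + d)" "length v = Suc (a + d)"
        and b: "\<And>i. i < Suc (a + d) \<Longrightarrow> u ! i \<in> {1..Suc i}" "\<And>i. i < Suc (a + d) \<Longrightarrow> v ! i \<in> {1..Suc i}"
        and k: "(take a u, take a v) \<in> kernel_positions a"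
        and ge: "\<And>j. a \<le> j \<Longrightarrow> j < a + d \<Longrightarrow> u ! a \<le> v ! j" and lt: "v ! (a + d) < u ! a"
        by (auto simp: kernel_extensions_def bernoulli_positions_def bernoulli_word_iff)
      have "drop (Suc a) u \<in> words d (\<lambda>i. {1..a + 2 + i})"
        using b(1)[of "Suc a + i" for i] len by (auto simp: words_def)
      moreover have "take d (drop a v) \<in> words d (\<lambda>i. {u ! a..a + 1 + i})"
        using b(2)[of "a + i" for i] ge[of "a + i" for i] len by (auto simp: words_def)
      ultimately show "?g p \<in> ?A"
        using p k lt b(1)[of a] b(2)[of "a + d"] by auto
    qed
  qed
qed

lemma card_kernel_extensions:
  assumes "1 \<le> a" "a < n"
  shows "card (kernel_extensions a n) =
    kappa a * ((fact (n - a - 1))\<^sup>2 * (n choose (a + 1)) * (n choose (a - 1)))"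
proof -
  define d where "d = n - a - 1"
  have n: "n = Suc (a + d)"
    using assms by (simp add: d_def)
  have u': "card (words d (\<lambda>i. {1..a + 2 + i})) = fact d * (n choose (a + 1))"
  proof -
    have "card (words d (\<lambda>i. {1..a + 2 + i})) = fact d * (Suc a + d choose d)"
      using prod_consecutive_eq_fact_mult_binomial[of "Suc a" d] by (simp add: card_words)
    also have "(Suc a + d choose d) = (n choose (a + 1))"
      unfolding n by (subst binomial_symmetric) auto
    finally show ?thesis .
  qed
  \<comment> \<open>Place \<open>i\<close> allows \<open>Suc (a - (x - 1) + i)\<close> letters; the
    range of \<open>x\<close> makes both subtractions exact.\<close>
  have v': "card (words d (\<lambda>i. {x..a + 1 + i})) = fact d * (a - (x - 1) + d choose d)"
    if "x \<in> {1..Suc a}" for x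
    using prod_consecutive_eq_fact_mult_binomial[of "a - (x - 1)" d] that
    by (simp add: card_words Suc_diff_le)
  have "card (kernel_extensions a n) = card (kernel_positions a \<times> (SIGMA x:{1..Suc a}.
        words d (\<lambda>i. {1..a + 2 + i}) \<times> words d (\<lambda>i. {x..a + 1 + i}) \<times> {1..<x}))"
    using bij_betw_same_card[OF bij_betw_kernel_extensions[of a d]] n by simp
  also have "\<dots> = kappa a * (\<Sum>x\<in>{1..Suc a}. card (words d (\<lambda>i. {1..a + 2 + i})) *
      (card (words d (\<lambda>i. {x..a + 1 + i})) * (x - 1)))"
    by (subst card_cartesian_product, subst card_SigmaI)
      (auto simp: card_cartesian_product kappa_def intro!: finite_cartesian_product finite_words)
  also have "(\<Sum>x\<in>{1..Suc a}. card (words d (\<lambda>i. {1..a + 2 + i})) *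
      (card (words d (\<lambda>i. {x..a + 1 + i})) * (x - 1))) =
      (\<Sum>x\<in>{1..Suc a}. fact d * (n choose (a + 1)) * (fact d * (a - (x - 1) + d choose d) * (x - 1)))"
    by (intro sum.cong refl) (simp only: u' v')
  also have "\<dots> = (\<Sum>y\<le>a. fact d * (n choose (a + 1)) * (fact d * (a - y + d choose d) * y))"
    by (rule sum.reindex_bij_witness[of _ Suc "\<lambda>x. x - 1"]) auto
  also have "\<dots> = (fact d)\<^sup>2 * (n choose (a + 1)) * (\<Sum>y\<le>a. y * (a - y + d choose d))"
    by (simp add: sum_distrib_left power2_eq_square mult_ac)
  \<comment> \<open>As n = a+d+1, the complement of d+2 in n is a-1, where \<open>1 \<le> a\<close>
    is used.\<close>
  also have "(\<Sum>y\<le>a. y * (a - y + d choose d)) = (n choose (a - 1))"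
    unfolding sum_mult_choose n using assms(1) by (subst binomial_symmetric) auto
  finally show ?thesis
    by (simp add: d_def)
qed

lemma kappa_1: "kappa 1 = 1"
proof -
  have p: "([1], [1]) \<in> bernoulli_positions 1"
    by (simp add: bernoulli_positions_def bernoulli_word_iff)
  have "([1], [1]) \<in> kernel_positions 1"
    using take_in_kernel_positions_iff[OF p, of 1] by simp
  moreover have "kernel_positions 1 \<subseteq> {([1], [1])}"
    by (auto simp: kernel_positions_def bernoulli_positions_def bernoulli_word_iff length_Suc_conv)
  ultimately have "kernel_positions 1 = {([1], [1])}"
    by blast
  then show ?thesis
    by (simp add: kappa_def)
qed

subsection \<open>Sums over index chains\<close>

lemma index_chains_0: "index_chains 0 n = (if 1 < n then {[1, n]} else {})"
  by (auto simp: index_chains_def length_Suc_conv numeral_2_eq_2)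

text \<open>Cutting off the last index leaves a chain ending at the previous index
  \<open>a\<close>.\<close>

lemma index_chains_Suc: "index_chains (Suc k) n = (\<Union>a<n. (\<lambda>i. i @ [n]) ` index_chains k a)"
proof (intro equalityI subsetI)
  fix i assume i: "i \<in> index_chains (Suc k) n"
  then have len: "length i = Suc (k + 2)"
    by (simp add: index_chains_def)
  have split: "i = take (k + 2) i @ [n]"
    using i len take_Suc_conv_app_nth[of "k + 2" i] by (simp add: index_chains_def)
  have "sorted_wrt (<) (take (k + 2) i @ [n])"
    using i split by (simp add: index_chains_def)
  then have "take (k + 2) i \<in> index_chains k (i ! (k + 1))" "i ! (k + 1) < n"
    using i len sorted_wrt_nth_less[of "(<)" i "k + 1" "k + 2"]
    by (auto simp: index_chains_def sorted_wrt_append)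
  with split show "i \<in> (\<Union>a<n. (\<lambda>i. i @ [n]) ` index_chains k a)"
    by blast
next
  fix i assume "i \<in> (\<Union>a<n. (\<lambda>i. i @ [n]) ` index_chains k a)"
  then obtain a i' where a: "a < n" and i': "i' \<in> index_chains k a" and i: "i = i' @ [n]"
    by auto
  have "x \<le> a" if x: "x \<in> set i'" for x
  proof -
    obtain j where "j < k + 2" "x = i' ! j"
      using x i' by (auto simp: in_set_conv_nth index_chains_def)
    then show ?thesis
      using i' sorted_wrt_nth_less[of "(<)" i' j "k + 1"]
      by (cases "j = k + 1") (auto simp: index_chains_def)
  qed
  then show "i \<in> index_chains (Suc k) n"
    using a i' i by (auto simp: index_chains_def sorted_wrt_append nth_append intro: le_less_trans)
qed

lemma index_chains_eq_empty: "n < k + 2 \<Longrightarrow> index_chains k n = {}"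
proof (induction k arbitrary: n)
  case (Suc k)
  then show ?case by (simp add: index_chains_Suc)
qed (simp add: index_chains_0)

text \<open>The inner sum of the theorem with an arbitrary weight: the total weight of increasing
  paths from 1 to \<open>n\<close> with \<open>k + 1\<close> edges.\<close>

definition chain_sum :: "(nat \<Rightarrow> nat \<Rightarrow> 'a::comm_semiring_1) \<Rightarrow> nat \<Rightarrow> nat \<Rightarrow> 'a" where
  "chain_sum w k n = (\<Sum>i\<in>index_chains k n. \<Prod>j = 0..k. w (i ! j) (i ! (j + 1)))"

lemma chain_sum_0: "chain_sum w 0 n = (if 1 < n then w 1 n else 0)"
  by (simp add: chain_sum_def index_chains_0)

lemma chain_sum_eq_0: "n < k + 2 \<Longrightarrow> chain_sum w k n = 0"
  by (simp add: chain_sum_def index_chains_eq_empty)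

lemma chain_sum_Suc: "chain_sum w (Suc k) n = (\<Sum>a<n. chain_sum w k a * w a n)"
proof -
  let ?g = "\<lambda>i. \<Prod>j = 0..Suc k. w (i ! j) (i ! (j + 1))"
  have last: "i ! (k + 1) = a" "length i = k + 2" if "i \<in> index_chains k a" for i a
    using that by (auto simp: index_chains_def)
  \<comment> \<open>The sets are disjoint because \<open>a\<close> is recovered as the entry at
    index \<open>k + 1\<close>.\<close>
  have "chain_sum w (Suc k) n = (\<Sum>a<n. \<Sum>i\<in>(\<lambda>i. i @ [n]) ` index_chains k a. ?g i)"
    unfolding chain_sum_def index_chains_Suc
    by (rule sum.UNION_disjoint) (auto simp: finite_index_chains dest: last(1))
  also have "\<dots> = (\<Sum>a<n. \<Sum>i\<in>index_chains k a. ?g (i @ [n]))"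
    by (subst sum.reindex) (auto simp: inj_on_def)
  also have "\<dots> = (\<Sum>a<n. \<Sum>i\<in>index_chains k a. (\<Prod>j = 0..k. w (i ! j) (i ! (j + 1))) * w a n)"
  proof (intro sum.cong refl)
    fix a i assume i: "i \<in> index_chains k a"
    have "(\<Prod>j = 0..k. w ((i @ [n]) ! j) ((i @ [n]) ! (j + 1))) = (\<Prod>j = 0..k. w (i ! j) (i ! (j + 1)))"
      by (intro prod.cong) (auto simp: nth_append last[OF i])
    then show "?g (i @ [n]) = (\<Prod>j = 0..k. w (i ! j) (i ! (j + 1))) * w a n"
      using last[OF i] by (simp add: nth_append)
  qed
  finally show ?thesis
    by (simp add: chain_sum_def sum_distrib_right)
qed

text \<open>
  The upper bound \<open>N\<close> is left free because the induction hypothesis is needed for all \<open>a < n\<close> with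
  the same range of summation.
\<close>

lemma recurrence_eq_sum_chain_sum:
  fixes f :: "nat \<Rightarrow> 'a::comm_semiring_1"
  assumes f1: "f 1 = 1" and rec: "\<And>n. 2 \<le> n \<Longrightarrow> f n = (\<Sum>a = 1..<n. f a * w a n)"
  shows "2 \<le> n \<Longrightarrow> n \<le> Suc N \<Longrightarrow> f n = (\<Sum>k<N. chain_sum w k n)"
proof (induction n arbitrary: N rule: less_induct)
  case (less n)
  then obtain M where N: "N = Suc M"
    by (cases N) auto
  \<comment> \<open>The chain without intermediate index is split off; it matches the summand
    \<open>a = 1\<close> of the recurrence because \<open>f 1 = 1\<close>.\<close>
  have "(\<Sum>k<N. chain_sum w k n) = w 1 n + (\<Sum>k<M. \<Sum>a<n. chain_sum w k a * w a n)"
    using less.prems unfolding N sum.lessThan_Suc_shift by (simp add: chain_sum_0 chain_sum_Suc)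
  also have "(\<Sum>k<M. \<Sum>a<n. chain_sum w k a * w a n) = (\<Sum>a<n. (\<Sum>k<M. chain_sum w k a) * w a n)"
    unfolding sum_distrib_right by (rule sum.swap)
  \<comment> \<open>No chain from 1 ends below 2, so the summands for 0 and 1 vanish.\<close>
  also have "\<dots> = (\<Sum>a = 2..<n. (\<Sum>k<M. chain_sum w k a) * w a n)"
    by (rule sum.mono_neutral_right) (auto simp: chain_sum_eq_0)
  \<comment> \<open>From a < n \<le> \<open>Suc (Suc M)\<close> follows a \<le>
    \<open>Suc M\<close>, so the induction hypothesis applies with the bound
    \<open>M\<close>.\<close>
  also have "\<dots> = (\<Sum>a = 2..<n. f a * w a n)"
    using less.prems N by (intro sum.cong refl) (simp add: less.IH[of _ M])
  also have "w 1 n + \<dots> = (\<Sum>a = 1..<n. f a * w a n)"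
    using less.prems by (simp add: sum.atLeast_Suc_lessThan[of "Suc 0"] f1[simplified] numeral_2_eq_2)
  finally show ?case
    using rec less.prems by simp
qed

theorem theorem3p4:
  fixes n :: nat
  assumes "n \<ge> 2"
  shows "kappa n =
    (\<Sum>k = 0..n - 2. \<Sum>i \<in> index_chains k n.
       \<Prod>j = 0..k. (fact (i ! (j + 1) - i ! j - 1))\<^sup>2
         * (i ! (j + 1) choose (i ! j + 1))
         * (i ! (j + 1) choose (i ! j - 1)))"
proof -
  let ?w = "\<lambda>a b. (fact (b - a - 1))\<^sup>2 * (b choose (a + 1)) * (b choose (a - 1)) :: nat"
  have "kappa m = (\<Sum>a = 1..<m. kappa a * ?w a m)" if "2 \<le> m" for m
    unfolding kappa_eq_sum_card_kernel_extensions[OF that]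
    by (intro sum.cong refl card_kernel_extensions) auto
  \<comment> \<open>The bound \<open>n - 1\<close> is the smallest admissible one and yields exactly
    the range of k in the theorem.\<close>
  then have "kappa n = (\<Sum>k<n - 1. chain_sum ?w k n)"
    using recurrence_eq_sum_chain_sum[of kappa ?w n "n - 1"] kappa_1 assms by simp
  also have "{..<n - 1} = {0..n - 2}"
    using assms by auto
  finally show ?thesis
    unfolding chain_sum_def .
qed

end
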